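(* Let $(X,d)$ be a CAT(0) space. Let $(T_n)_{n\in\mathbb{N}}$ be a family of self-mappings of $X$ and $p\in\bigcap_{n\in\mathbb{N}}\mathrm{Fix}(T_n)$. Let $(\gamma_n)_{n\in\mathbb{N}}\subseteq(0,\infty)$ and $\theta:(0,\infty)\to\mathbb{N}$, and assume that for all $x>0$, $$\sum_{n=0}^{\theta(x)}\gamma_n\ge x.$$ Let $b>0$ and denote by $C$ the closed ball of center $p$ and radius $b$. Let $\varphi:(0,\infty)\to(0,\infty)$ and assume that for all $n\in\mathbb{N}$, $T_n(C)\subseteq C$ and $T_n$ is uniformly $(P_2)$ on $C$ with modulus $\gamma_n\varphi$. Let $(x_n)_{n\in\mathbb{N}}\subseteq C$ be such that for all $n\in\mathbb{N}$, $x_{n+1}=T_nx_n$. Then for all $\varepsilon>0$ and all $n\ge\theta\left(\frac{(b+1)^2}{\varphi(\varepsilon)}\right)+1$, $$d(x_n,p)\le\varepsilon.$$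
   Context: A metric space $(X,d)$ is geodesic if for any $x,y\in X$ there is a geodesic joining them, i.e. a map $\gamma:[0,1]\to X$ with $\gamma(0)=x$, $\gamma(1)=y$ and $d(\gamma(t),\gamma(t'))=|t-t'|d(x,y)$ for all $t,t'\in[0,1]$. A CAT(0) space is a geodesic space $(X,d)$ such that for any geodesic $\gamma:[0,1]\to X$, any $z\in X$ and any $t\in[0,1]$, $d^2(z,\gamma(t))\le(1-t)d^2(z,\gamma(0))+td^2(z,\gamma(1))-t(1-t)d^2(\gamma(0),\gamma(1))$. (Here $d^2(x,y)$ means $(d(x,y))^2$.) $\mathbb{N}$ contains $0$. $\mathrm{Fix}(T)$ denotes the set of fixed points of a self-mapping $T$. If $T$ is a self-mapping of $X$ and $C$ is a nonempty subset of $X$ with $T(C)\subseteq C$, then $T$ is uniformly $(P_2)$ on $C$ with modulus $\psi:(0,\infty)\to(0,\infty)$ if for all $\varepsilon>0$ and all $x,y\in C$ with $d(Tx,Ty)\ge\varepsilon$, $$2d^2(Tx,Ty)\le d^2(x,Ty)+d^2(y,Tx)-d^2(x,Tx)-d^2(y,Ty)-2\psi(\varepsilon).$$ The modulus $\gamma_n\varphi$ is the function $\varepsilon\mapsto\gamma_n\varphi(\varepsilon)$. *)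

theory Defs
  imports "HOL-Analysis.Abstract_Metric_Spaces"
begin

context Metric_space
begin

text \<open>Geodesics are parametrised proportionally to arc length on the unit interval; values
  of \<^term>\<open>g\<close> outside that interval are irrelevant.\<close>

definition geodesic :: "(real \<Rightarrow> 'a) \<Rightarrow> bool" where
  "geodesic g \<longleftrightarrow> g \<in> {0..1} \<rightarrow> M \<and>
     (\<forall>t\<in>{0..1}. \<forall>t'\<in>{0..1}. d (g t) (g t') = \<bar>t - t'\<bar> * d (g 0) (g 1))"

definition geodesic_joining :: "(real \<Rightarrow> 'a) \<Rightarrow> 'a \<Rightarrow> 'a \<Rightarrow> bool" where
  "geodesic_joining g x y \<longleftrightarrow> geodesic g \<and> g 0 = x \<and> g 1 = y"

definition uniformly_P2_on :: "('a \<Rightarrow> 'a) \<Rightarrow> 'a set \<Rightarrow> (real \<Rightarrow> real) \<Rightarrow> bool" where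
  "uniformly_P2_on T C \<psi> \<longleftrightarrow>
     T \<in> M \<rightarrow> M \<and> C \<noteq> {} \<and> C \<subseteq> M \<and> T ` C \<subseteq> C \<and> (\<forall>\<epsilon>>0. \<psi> \<epsilon> > 0) \<and>
     (\<forall>\<epsilon>>0. \<forall>x\<in>C. \<forall>y\<in>C. d (T x) (T y) \<ge> \<epsilon> \<longrightarrow>
        2 * (d (T x) (T y))\<^sup>2 \<le>
          (d x (T y))\<^sup>2 + (d y (T x))\<^sup>2 - (d x (T x))\<^sup>2 - (d y (T y))\<^sup>2 - 2 * \<psi> \<epsilon>)"

end

locale Geodesic_space = Metric_space +
  assumes geodesic_exists: "\<lbrakk>x \<in> M; y \<in> M\<rbrakk> \<Longrightarrow> \<exists>g. geodesic_joining g x y"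

locale CAT0_space = Geodesic_space +
  assumes CAT0_inequality:
    "\<lbrakk>geodesic g; z \<in> M; 0 \<le> t; t \<le> 1\<rbrakk> \<Longrightarrow>
       (d z (g t))\<^sup>2 \<le> (1 - t) * (d z (g 0))\<^sup>2 + t * (d z (g 1))\<^sup>2 - t * (1 - t) * (d (g 0) (g 1))\<^sup>2"

definition Fix :: "'a set \<Rightarrow> ('a \<Rightarrow> 'a) \<Rightarrow> 'a set" where
  "Fix X T = {x \<in> X. T x = x}"

end

theory Submission
  imports Defs
begin

text \<open>Condition \<open>(P\<^sub>2)\<close> applied to \<open>x\<^sub>n\<close> and \<open>p\<close> shows that the squared distance to \<open>p\<close> never
  increases, and that it drops by at least \<open>2 \<gamma>\<^sub>n \<phi>(\<epsilon>)\<close> whenever \<open>x\<^sub>n\<^sub>+\<^sub>1\<close> is still at distance at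
  least \<open>\<epsilon>\<close> from \<open>p\<close>. Starting from at most \<open>b\<^sup>2\<close>, this cannot go on until the sum of the
  \<open>\<gamma>\<^sub>n\<close> exceeds \<open>b\<^sup>2 / (2 \<phi>(\<epsilon>))\<close>.\<close>

context Metric_space
begin

text \<open>Take \<open>y = p\<close> in the condition: \<open>d y (T y)\<close> vanishes, one of
  the two copies of \<open>(d (T u) p)\<^sup>2\<close> cancels, and
  \<open>- (d u (T u))\<^sup>2\<close> can be discarded.\<close>

lemma uniformly_P2_on_fixpoint_decrease:
  assumes P2: "uniformly_P2_on T C \<psi>"
    and "p \<in> C" "T p = p" "u \<in> C" "\<epsilon> > 0" "d (T u) p \<ge> \<epsilon>"
  shows "(d (T u) p)\<^sup>2 + 2 * \<psi> \<epsilon> \<le> (d u p)\<^sup>2"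
proof -
  have "p \<in> M"
    using P2 \<open>p \<in> C\<close> by (auto simp: uniformly_P2_on_def)
  have "2 * (d (T u) (T p))\<^sup>2 \<le>
      (d u (T p))\<^sup>2 + (d p (T u))\<^sup>2 - (d u (T u))\<^sup>2 - (d p (T p))\<^sup>2 - 2 * \<psi> \<epsilon>"
    using P2 \<open>p \<in> C\<close> \<open>u \<in> C\<close> \<open>\<epsilon> > 0\<close> \<open>d (T u) p \<ge> \<epsilon>\<close> \<open>T p = p\<close>[symmetric]
    unfolding uniformly_P2_on_def by metis
  then have "2 * (d (T u) p)\<^sup>2 \<le>
      (d u p)\<^sup>2 + (d (T u) p)\<^sup>2 - (d u (T u))\<^sup>2 - 2 * \<psi> \<epsilon>"
    using \<open>T p = p\<close> \<open>p \<in> M\<close> by (simp add: commute[of p "T u"])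
  then show ?thesis
    using zero_le_power2[of "d u (T u)"] by linarith
qed

text \<open>The threshold is the distance \<open>d (T u) p\<close> itself, which is always met.
  Distance zero is treated apart, since the modulus is positive only at positive arguments.\<close>

lemma uniformly_P2_on_fixpoint_nonexpansive:
  assumes P2: "uniformly_P2_on T C \<psi>"
    and "p \<in> C" "T p = p" "u \<in> C"
  shows "d (T u) p \<le> d u p"
proof (cases "d (T u) p = 0")
  case False
  then have pos: "d (T u) p > 0"
    using nonneg[of "T u" p] by linarith
  with P2 have "\<psi> (d (T u) p) > 0"
    by (auto simp: uniformly_P2_on_def)
  with uniformly_P2_on_fixpoint_decrease[OF assms pos order_refl]
  have "(d (T u) p)\<^sup>2 \<le> (d u p)\<^sup>2"
    by linarith
  then show ?thesis
    by (rule power2_le_imp_le) simp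
qed simp

lemma uniformly_P2_on_orbit_decrease:
  assumes P2: "\<And>n. uniformly_P2_on (T n) C (\<lambda>\<epsilon>. \<gamma> n * \<phi> \<epsilon>)"
    and p: "p \<in> C" "\<And>n. T n p = p"
    and x: "\<And>n. x n \<in> C" "\<And>n. x (Suc n) = T n (x n)"
    and "\<epsilon> > 0" "d (x n) p \<ge> \<epsilon>"
  shows "(d (x n) p)\<^sup>2 + 2 * \<phi> \<epsilon> * (\<Sum>k<n. \<gamma> k) \<le> (d (x 0) p)\<^sup>2"
  using \<open>d (x n) p \<ge> \<epsilon>\<close>
proof (induction n)
  case (Suc n)
  \<comment> \<open>Distances to \<open>p\<close> do not increase along the orbit, so the bound by
    \<epsilon> from below passes from index \<open>Suc n\<close> back to \<open>n\<close> and the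
    induction hypothesis applies.\<close>
  have "d (x (Suc n)) p \<le> d (x n) p"
    using uniformly_P2_on_fixpoint_nonexpansive[OF P2 p x(1)] x(2) by simp
  with Suc have "(d (x n) p)\<^sup>2 + 2 * \<phi> \<epsilon> * (\<Sum>k<n. \<gamma> k) \<le> (d (x 0) p)\<^sup>2"
    by linarith
  moreover have "(d (x (Suc n)) p)\<^sup>2 + 2 * (\<gamma> n * \<phi> \<epsilon>) \<le> (d (x n) p)\<^sup>2"
    using uniformly_P2_on_fixpoint_decrease[OF P2 p x(1) \<open>\<epsilon> > 0\<close>] Suc.prems x(2) by simp
  ultimately show ?case
    by (simp add: algebra_simps)
qed simp

end

theorem theorem4p3:
  fixes X :: "'a set" and d :: "'a \<Rightarrow> 'a \<Rightarrow> real"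
    and T :: "nat \<Rightarrow> 'a \<Rightarrow> 'a" and p :: 'a
    and \<gamma> :: "nat \<Rightarrow> real" and \<theta> :: "real \<Rightarrow> nat"
    and b :: real and C :: "'a set" and \<phi> :: "real \<Rightarrow> real" and x :: "nat \<Rightarrow> 'a"
  assumes "CAT0_space X d"
    and "\<And>n. T n \<in> X \<rightarrow> X"
    and "p \<in> (\<Inter>n. Fix X (T n))"
    and "\<And>n. \<gamma> n > 0"
    and "\<And>r. r > 0 \<Longrightarrow> (\<Sum>n=0..\<theta> r. \<gamma> n) \<ge> r"
    and "b > 0"
    and "C = Metric_space.mcball X d p b"
    and "\<And>\<epsilon>. \<epsilon> > 0 \<Longrightarrow> \<phi> \<epsilon> > 0"
    and "\<And>n. T n ` C \<subseteq> C"
    and "\<And>n. Metric_space.uniformly_P2_on X d (T n) C (\<lambda>\<epsilon>. \<gamma> n * \<phi> \<epsilon>)"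
    and "\<And>n. x n \<in> C"
    and "\<And>n. x (Suc n) = T n (x n)"
  shows "\<forall>\<epsilon>>0. \<forall>n \<ge> \<theta> ((b + 1)\<^sup>2 / \<phi> \<epsilon>) + 1. d (x n) p \<le> \<epsilon>"
proof (intro allI impI)
  fix \<epsilon> :: real and n :: nat
  assume \<epsilon>: "\<epsilon> > 0" and n: "n \<ge> \<theta> ((b + 1)\<^sup>2 / \<phi> \<epsilon>) + 1"
  interpret CAT0_space X d by fact
  \<comment> \<open>Chosen so that \<open>\<phi> \<epsilon> * r\<close> is
    \<open>(b + 1)\<^sup>2\<close>, more than the initial squared distance, which is at most
    \<open>b\<^sup>2\<close>.\<close>
  define r where "r = (b + 1)\<^sup>2 / \<phi> \<epsilon>"
  have \<phi>: "\<phi> \<epsilon> > 0"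
    using assms(8) \<epsilon> .
  with \<open>b > 0\<close> have "r > 0"
    by (simp add: r_def)
  have fix_p: "T k p = p" and "p \<in> X" for k
    using assms(3) by (auto simp: Fix_def)
  then have "p \<in> C"
    using \<open>b > 0\<close> by (simp add: assms(7))
  show "d (x n) p \<le> \<epsilon>"
  proof (rule ccontr)
    assume "\<not> d (x n) p \<le> \<epsilon>"
    then have "(d (x n) p)\<^sup>2 + 2 * \<phi> \<epsilon> * (\<Sum>k<n. \<gamma> k) \<le> (d (x 0) p)\<^sup>2"
      using uniformly_P2_on_orbit_decrease[where T = T and x = x and \<gamma> = \<gamma> and \<phi> = \<phi>,
          OF assms(10) \<open>p \<in> C\<close> fix_p assms(11,12) \<epsilon>] by simp
    moreover have "r \<le> (\<Sum>k<n. \<gamma> k)"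
    proof -
      have "r \<le> (\<Sum>k=0..\<theta> r. \<gamma> k)"
        using assms(5) \<open>r > 0\<close> .
      \<comment> \<open>The sum up to \<open>\<theta> r\<close> is inclusive, while reaching
        \<open>x n\<close> uses only the indices below \<open>n\<close>; hence the
        \<open>+ 1\<close> in the rate.\<close>
      also have "\<dots> \<le> (\<Sum>k<n. \<gamma> k)"
        using n assms(4) by (intro sum_mono2) (auto simp: r_def less_imp_le)
      finally show ?thesis .
    qed
    then have "\<phi> \<epsilon> * r \<le> \<phi> \<epsilon> * (\<Sum>k<n. \<gamma> k)"
      using \<phi> by simp
    then have "(b + 1)\<^sup>2 \<le> \<phi> \<epsilon> * (\<Sum>k<n. \<gamma> k)"
      using \<phi> by (simp add: r_def)
    moreover have "(d (x 0) p)\<^sup>2 \<le> b\<^sup>2"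
      using assms(11)[of 0] by (intro power_mono) (auto simp: assms(7) commute)
    moreover have "b\<^sup>2 < (b + 1)\<^sup>2"
      using \<open>b > 0\<close> by (intro power_strict_mono) auto
    \<comment> \<open>The total drop would be at least \<open>2 * (b + 1)\<^sup>2\<close>, but at
      most \<open>b\<^sup>2\<close> is available.\<close>
    ultimately show False
      using zero_le_power2[of "d (x n) p"] zero_le_power2[of b] by linarith
  qed
qed

end
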